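(* (1) Let $\kappa$ be an infinite cardinal such that $2^\kappa<2^{\kappa^+}$, and let $\lambda$ be a cardinal with $2^\kappa<\lambda\leq 2^{\kappa^+}$. Then for every family $\{C_\alpha:\alpha<\lambda\}\subseteq\mathcal{D}_{\kappa^+}$ there is a subfamily of cardinality $\kappa^+$ whose intersection belongs to $\mathcal{D}_{\kappa^+}$; that is, there is $I\subseteq\lambda$ with $|I|=\kappa^+$ and $\bigcap_{\alpha\in I}C_\alpha\in\mathcal{D}_{\kappa^+}$. (2) Let $\kappa$ be an inaccessible cardinal (an uncountable regular limit cardinal) such that $\kappa=\kappa^{<\kappa}$, and let $\lambda$ be a cardinal with $\kappa^+\leq\lambda\leq 2^\kappa$. Then for every family $\{C_\alpha:\alpha<\lambda\}\subseteq\mathcal{D}_\kappa$ there is a subfamily of cardinality $\kappa$ whose intersection belongs to $\mathcal{D}_\kappa$; that is, there is $I\subseteq\lambda$ with $|I|=\kappa$ and $\bigcap_{\alpha\in I}C_\alpha\in\mathcal{D}_\kappa$.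
   Context: For a regular uncountable cardinal $\mu$, $\mathcal{D}_\mu$ denotes the club filter on $\mu$: the collection of all subsets of $\mu$ that contain a closed unbounded subset of $\mu$. Families are indexed families, and the cardinality of a subfamily is the cardinality of its set of indices. *)

theory Defs
  imports Main
begin

unbundle cardinal_syntax

text \<open>
  Cardinals are the initial well-orders of the BNF cardinal library: a cardinal is a relation
  \<open>r\<close> with \<open>Card_order r\<close>, and its elements as an ordinal are the members of \<open>Field r\<close>.
  Up to isomorphism every cardinal below \<open>r\<close> is represented on the type of \<open>r\<close>.
\<close>

text \<open>
  \<open>C\<close> contains every \<open>d\<close> in which \<open>C\<close> is unbounded. As unboundedness is
  expressed by \<open>cofinal\<close>, which asks for strictly larger elements, only limit \<open>d\<close> are concerned.
  For reflexive \<open>r\<close>, the field of the restricted order is \<open>underS r d\<close>.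
\<close>
definition closed_in_order :: "'a rel \<Rightarrow> 'a set \<Rightarrow> bool" where
  "closed_in_order r C \<longleftrightarrow>
     (\<forall>d \<in> Field r. underS r d \<noteq> {} \<and>
        cofinal (C \<inter> underS r d) (Restr r (underS r d)) \<longrightarrow> d \<in> C)"

definition club :: "'a rel \<Rightarrow> 'a set \<Rightarrow> bool" where
  "club r C \<longleftrightarrow> C \<subseteq> Field r \<and> closed_in_order r C \<and> cofinal C r"

definition club_filter :: "'a rel \<Rightarrow> 'a set set" where
  "club_filter r = {X. X \<subseteq> Field r \<and> (\<exists>C. club r C \<and> C \<subseteq> X)}"

definition limit_cardinal :: "'a rel \<Rightarrow> bool" where
  "limit_cardinal r \<longleftrightarrow> Cinfinite r \<and>
     (\<forall>s :: 'a rel. Card_order s \<and> s <o r \<longrightarrow> cardSuc s <o r)"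

text \<open>Weakly inaccessible: uncountable, regular and limit.\<close>
definition inaccessible_cardinal :: "'a rel \<Rightarrow> bool" where
  "inaccessible_cardinal r \<longleftrightarrow>
     Card_order r \<and> natLeq <o r \<and> regularCard r \<and> limit_cardinal r"

text \<open>
  \<open>r\<close> to the power \<open>< s\<close>: the number of sequences of elements of \<open>r\<close> whose length is an ordinal
  \<open>a < s\<close>. The length is kept as a tag because \<open>Func\<close> uses total functions, for which
  domains are not recoverable.
\<close>
definition cexp_less :: "'a rel \<Rightarrow> 'b rel \<Rightarrow> ('b \<times> ('b \<Rightarrow> 'a)) rel" where
  "cexp_less r s = |SIGMA a : Field s. Func (underS s a) (Field r)|"

end

theory Submission
  imports Defs
begin

text \<open>
  Both parts are instances of Galvin's theorem for a regular uncountable cardinal \<open>\<mu>\<close>: if there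
  are fewer than \<open>|A|\<close> pairs consisting of an \<open>\<epsilon> < \<mu>\<close> and a subset of \<open>\<epsilon>\<close>, then any family of
  sets in the club filter indexed by \<open>A\<close> has \<open>\<mu>\<close> many members whose intersection is still in the
  club filter. In the first part \<open>\<mu> = \<kappa>\<^sup>+\<close> and there are at most \<open>2\<^sup>\<kappa>\<close> such pairs; in the second
  \<open>\<mu> = \<kappa>\<close> and there are at most \<open>\<kappa>\<^sup><\<^sup>\<kappa> = \<kappa>\<close> of them.

  The club filter is not closed under intersections of \<open>\<mu>\<close> sets, but it is closed under
  diagonal intersections \<open>{\<delta>. \<forall>\<epsilon> < \<delta>. \<delta> \<in> D \<epsilon>}\<close> (lemma \<open>club_diagonal\<close>), so a point \<open>\<delta>\<close> of
  a diagonal intersection may only miss those \<open>D \<epsilon>\<close> with \<open>\<epsilon> \<ge> \<delta>\<close>. The remedy is to select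
  the members of the subfamily so that they agree with a single set \<open>C \<alpha>0\<close> on longer and longer
  initial segments: if \<open>C (i \<epsilon>)\<close> and \<open>C \<alpha>0\<close> have the same elements up to and including \<open>\<epsilon>\<close>, then
  a point \<open>\<delta> \<le> \<epsilon>\<close> of \<open>C \<alpha>0\<close> lies in \<open>C (i \<epsilon>)\<close> automatically. Hence
  \<open>C \<alpha>0\<close> meets the diagonal intersection of the \<open>C (i \<epsilon>)\<close> inside their full intersection
  (theorem \<open>galvin\<close>).

  Such a selection, with \<open>i\<close> injective, exists as soon as for every \<open>\<epsilon>\<close> at least \<open>\<mu>\<close> many
  members of the family agree with \<open>C \<alpha>0\<close> below \<open>\<epsilon>\<close>. An index for which this fails at
  some \<open>\<epsilon>\<close> is determined by the pair \<open>(\<epsilon>, C \<alpha> \<inter> \<epsilon>)\<close> up to fewer than \<open>\<mu>\<close> possibilities, so there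
  are no more such indices than pairs, and \<open>A\<close> contains an index \<open>\<alpha>0\<close> of the other kind
  (lemma \<open>exists_popular_index\<close>).
\<close>

section \<open>Regular uncountable cardinals\<close>

locale regular_uncountable =
  fixes r :: "'a rel"
  assumes card: "Card_order r"
    and uncountable: "natLeq <o r"
    and regular: "regularCard r"
begin

abbreviation below :: "'a \<Rightarrow> 'a \<Rightarrow> bool" (infix "\<prec>" 50) where
  "a \<prec> b \<equiv> a \<in> underS r b"

lemma well_order: "Well_order r"
  using card by (simp add: card_order_on_def)

lemma wo_rel_r: "wo_rel r"
  using well_order by (simp add: wo_rel_def)

lemma infinite_Field: "infinite (Field r)"
  using card uncountable infinite_iff_natLeq_ordLeq ordLess_imp_ordLeq
    card_of_Field_ordIso ordLeq_ordIso_trans ordIso_symmetric by metis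

lemma below_Field: "a \<prec> b \<Longrightarrow> a \<in> Field r \<and> b \<in> Field r"
  by (auto simp: underS_def Field_def)

lemma below_trans: "a \<prec> b \<Longrightarrow> b \<prec> c \<Longrightarrow> a \<prec> c"
  using wo_rel.TRANS[OF wo_rel_r] wo_rel.ANTISYM[OF wo_rel_r]
  unfolding underS_def trans_def antisym_def by blast

lemma below_linear: "a \<in> Field r \<Longrightarrow> b \<in> Field r \<Longrightarrow> a \<prec> b \<or> a = b \<or> b \<prec> a"
  using wo_rel.TOTALS[OF wo_rel_r] unfolding underS_def by blast

lemma exists_above: "a \<in> Field r \<Longrightarrow> \<exists>b. a \<prec> b"
  using infinite_Card_order_limit[OF card infinite_Field] by (auto simp: underS_def)

lemma wf_below: "wf {(a, b). a \<prec> b}"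
proof -
  have "{(a, b). a \<prec> b} = r - Id" by (auto simp: underS_def)
  then show ?thesis using wo_rel.WF[OF wo_rel_r] by simp
qed

lemma card_underS_less: "a \<in> Field r \<Longrightarrow> |underS r a| <o r"
  by (rule card_of_underS[OF card])

lemma cofinal_iff: "cofinal X r \<longleftrightarrow> (\<forall>a\<in>Field r. \<exists>b\<in>X. a \<prec> b)"
  unfolding cofinal_def underS_def by auto

lemma cofinal_below_iff:
  "cofinal (X \<inter> underS r d) (Restr r (underS r d)) \<longleftrightarrow> (\<forall>a. a \<prec> d \<longrightarrow> (\<exists>b\<in>X. a \<prec> b \<and> b \<prec> d))"
proof -
  have "Field (Restr r (underS r d)) = underS r d"
    using wo_rel.REFL[OF wo_rel_r] below_Field by (intro Refl_Field_Restr2) auto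
  then show ?thesis unfolding cofinal_def underS_def by auto
qed

lemma closed_iff:
  "closed_in_order r X \<longleftrightarrow>
     (\<forall>d. (\<exists>a. a \<prec> d) \<and> (\<forall>a. a \<prec> d \<longrightarrow> (\<exists>b\<in>X. a \<prec> b \<and> b \<prec> d)) \<longrightarrow> d \<in> X)"
  unfolding closed_in_order_def cofinal_below_iff using below_Field by blast

lemma small_set_bounded:
  assumes "X \<subseteq> Field r" "|X| <o r"
  shows "\<exists>b\<in>Field r. \<forall>x\<in>X. x \<prec> b"
proof -
  have "\<not> cofinal X r"
    using assms regular not_ordLess_ordIso unfolding regularCard_def by blast
  then obtain a where a: "a \<in> Field r" "\<forall>x\<in>X. \<not> a \<prec> x"
    unfolding cofinal_iff by blast
  obtain b where "a \<prec> b" using exists_above a(1) by blast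
  then have "\<forall>x\<in>X. x \<prec> b"
    using a assms(1) below_linear below_trans by blast
  with \<open>a \<prec> b\<close> show ?thesis using below_Field by blast
qed

section \<open>Diagonal intersections\<close>

lemma step_into_unbounded_sets:
  assumes "|\<K>| <o r" "\<And>K. K \<in> \<K> \<Longrightarrow> K \<subseteq> Field r \<and> cofinal K r" "c \<in> Field r"
  shows "\<exists>b. c \<prec> b \<and> (\<forall>K\<in>\<K>. \<exists>x\<in>K. c \<prec> x \<and> x \<prec> b)"
proof -
  have "\<forall>K\<in>\<K>. \<exists>x\<in>K. c \<prec> x"
    using assms(2,3) unfolding cofinal_iff by blast
  then obtain p where p: "\<And>K. K \<in> \<K> \<Longrightarrow> p K \<in> K \<and> c \<prec> p K" by metis
  have "|p ` \<K>| <o r" using card_of_image assms(1) ordLeq_ordLess_trans by blast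
  moreover have "p ` \<K> \<subseteq> Field r" using p below_Field by blast
  ultimately obtain b where b: "b \<in> Field r" "\<forall>x\<in>p ` \<K>. x \<prec> b"
    using small_set_bounded by blast
  obtain c' where c': "c \<prec> c'" using exists_above assms(3) by blast
  show ?thesis
  proof (cases "c \<prec> b")
    case True
    then show ?thesis using b p by blast
  next
    case False
    then have "b \<prec> c'" using below_linear[OF b(1) assms(3)] c' below_trans by blast
    then have "\<forall>K\<in>\<K>. p K \<prec> c'" using b(2) below_trans by blast
    then show ?thesis using c' p by blast
  qed
qed

text \<open>
  The range of the sequence is countable, so regularity bounds it because the cardinal is
  uncountable; a least strict upper bound is then the supremum. For \<open>\<omega>\<close> itself this fails.
\<close>
lemma increasing_sequence_sup:
  fixes d :: "nat \<Rightarrow> 'a"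
  assumes "\<And>n. d n \<prec> d (Suc n)"
  shows "\<exists>s. (\<forall>n. d n \<prec> s) \<and> (\<forall>e. e \<prec> s \<longrightarrow> (\<exists>n. e \<prec> d n))"
proof -
  let ?B = "{b. \<forall>n. d n \<prec> b}"
  have "|range d| \<le>o |UNIV :: nat set|" by (rule card_of_image)
  also have "|UNIV :: nat set| =o natLeq" by (rule card_of_nat)
  finally have "|range d| <o r" using uncountable ordLeq_ordLess_trans by blast
  moreover have "range d \<subseteq> Field r" using assms below_Field by blast
  ultimately obtain b where b: "\<forall>x\<in>range d. x \<prec> b" using small_set_bounded[of "range d"] by blast
  then have "b \<in> ?B" by simp
  then obtain s where s: "s \<in> ?B" "\<And>y. (y, s) \<in> {(a, b). a \<prec> b} \<Longrightarrow> y \<notin> ?B"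
    using wfE_min[OF wf_below, of b ?B] by blast
  have "\<exists>n. e \<prec> d n" if e: "e \<prec> s" for e
  proof -
    obtain n where "\<not> d n \<prec> e" using s(2)[of e] e by auto
    then have "e \<prec> d n \<or> e = d n"
      using below_linear[of e "d n"] below_Field[OF e] below_Field[OF assms[of n]] by blast
    then show ?thesis using assms[of n] below_trans[of e "d n"] by blast
  qed
  then show ?thesis using s(1) by blast
qed

text \<open>
  Unboundedness needs no prior result on intersections of clubs: a step from \<open>c\<close> jumps over an
  element of each of the fewer than \<open>\<mu>\<close> many clubs \<open>K0\<close> and \<open>K \<epsilon>\<close> with \<open>\<epsilon> < c\<close>, and the
  supremum of \<open>\<omega>\<close> such steps is a limit of elements of every club that it has to belong to. The
  separate set \<open>K0\<close> provides the intersection with one further club.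
\<close>
lemma club_diagonal:
  assumes K0: "club r K0" and K: "\<And>e. e \<in> Field r \<Longrightarrow> club r (K e)"
  shows "club r {d \<in> K0. \<forall>e. e \<prec> d \<longrightarrow> d \<in> K e}" (is "club r ?D")
  unfolding club_def
proof (intro conjI)
  show "?D \<subseteq> Field r" using K0 unfolding club_def by blast
  have closed: "d \<in> X" if "club r X" "a \<prec> d" "\<And>a. a \<prec> d \<Longrightarrow> \<exists>b\<in>X. a \<prec> b \<and> b \<prec> d" for X a d
    using that unfolding club_def closed_iff by blast
  show "closed_in_order r ?D"
    unfolding closed_iff
  proof (intro allI impI, elim conjE exE)
    fix d a
    assume ad: "a \<prec> d" and lim: "\<forall>a. a \<prec> d \<longrightarrow> (\<exists>b\<in>?D. a \<prec> b \<and> b \<prec> d)"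
    have "d \<in> K0" using closed[OF K0 ad] lim by blast
    moreover have "d \<in> K e" if e: "e \<prec> d" for e
    proof (rule closed[OF K e])
      show "e \<in> Field r" using e below_Field by blast
      fix a assume a: "a \<prec> d"
      obtain m where m: "m \<prec> d" "e = m \<or> e \<prec> m" "a = m \<or> a \<prec> m"
        using below_linear[of a e] below_Field a e by blast
      then obtain b where b: "b \<in> ?D" "m \<prec> b" "b \<prec> d" using lim by blast
      then have "e \<prec> b" "a \<prec> b" using m below_trans by blast+
      then show "\<exists>b\<in>K e. a \<prec> b \<and> b \<prec> d" using b by blast
    qed
    ultimately show "d \<in> ?D" by blast
  qed
  show "cofinal ?D r"
    unfolding cofinal_iff
  proof
    fix a assume a: "a \<in> Field r"
    let ?\<K> = "\<lambda>c. insert K0 (K ` underS r c)"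
    have "\<exists>b. c \<prec> b \<and> (\<forall>X\<in>?\<K> c. \<exists>x\<in>X. c \<prec> x \<and> x \<prec> b)" if c: "c \<in> Field r" for c
    proof (rule step_into_unbounded_sets[OF _ _ c])
      have "|K ` underS r c| <o r"
        using card_of_image card_underS_less[OF c] ordLeq_ordLess_trans by blast
      moreover have "|{K0}| <o r"
        using finite_ordLess_infinite[OF card_of_Well_order[of "{K0}"] well_order] infinite_Field
        by (simp add: Field_card_of)
      ultimately have "|{K0} \<union> K ` underS r c| <o r"
        using card_of_Un_ordLess_infinite_Field[OF infinite_Field card] by blast
      then show "|?\<K> c| <o r" by simp
      show "X \<subseteq> Field r \<and> cofinal X r" if "X \<in> ?\<K> c" for X
        using that K0 K below_Field unfolding club_def by blast
    qed
    then obtain g where g: "\<And>c. c \<in> Field r \<Longrightarrow> c \<prec> g c"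
      "\<And>c X. c \<in> Field r \<Longrightarrow> X \<in> ?\<K> c \<Longrightarrow> \<exists>x\<in>X. c \<prec> x \<and> x \<prec> g c"
      by metis
    define d where "d n = (g ^^ n) a" for n
    have dF: "d n \<in> Field r" for n
      by (induction n) (use a g(1) below_Field in \<open>auto simp: d_def\<close>)
    have dS: "d (Suc n) = g (d n)" for n by (simp add: d_def)
    have inc: "d n \<prec> d (Suc n)" for n using g(1) dF dS by simp
    then obtain s where s: "\<And>n. d n \<prec> s" "\<And>e. e \<prec> s \<Longrightarrow> \<exists>n. e \<prec> d n"
      using increasing_sequence_sup by metis
    have inc_le: "d m = d n \<or> d m \<prec> d n" if "m \<le> n" for m n
      using that
    proof (induction rule: dec_induct)
      case (step k)
      then show ?case using inc[of k] below_trans[of "d m" "d k"] by auto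
    qed simp
    \<comment> \<open>A club that is visited by all but finitely many steps contains the supremum.\<close>
    have in_club: "s \<in> X" if X: "club r X" and m: "\<And>n. m \<le> n \<Longrightarrow> X \<in> ?\<K> (d n)" for X m
    proof (rule closed[OF X s(1)])
      fix c assume "c \<prec> s"
      then obtain k where k: "c \<prec> d k" using s(2) by blast
      define n where "n = max k m"
      have "c \<prec> d n" using k inc_le[of k n] below_trans unfolding n_def by auto
      moreover obtain x where "x \<in> X" "d n \<prec> x" "x \<prec> d (Suc n)"
        using g(2)[OF dF m[of n]] dS unfolding n_def by auto
      ultimately show "\<exists>b\<in>X. c \<prec> b \<and> b \<prec> s" using s(1) below_trans by blast
    qed
    have "s \<in> K0" by (rule in_club[OF K0, of 0]) simp
    moreover have "s \<in> K e" if e: "e \<prec> s" for e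
    proof -
      obtain m where m: "e \<prec> d m" using s(2)[OF e] by blast
      show ?thesis
      proof (rule in_club[OF K])
        show "e \<in> Field r" using e below_Field by blast
        show "K e \<in> ?\<K> (d n)" if "m \<le> n" for n
          using inc_le[OF that] m below_trans by auto
      qed
    qed
    moreover have "a \<prec> s" using s(1)[of 0] by (simp add: d_def)
    ultimately show "\<exists>b\<in>?D. a \<prec> b" by blast
  qed
qed

section \<open>Galvin's theorem\<close>

definition agreeing :: "'b set \<Rightarrow> ('b \<Rightarrow> 'a set) \<Rightarrow> 'b \<Rightarrow> 'a \<Rightarrow> 'b set" where
  "agreeing A C \<alpha> e = {\<beta> \<in> A. C \<beta> \<inter> underS r e = C \<alpha> \<inter> underS r e}"

text \<open>
  An index without the property has a witness \<open>w \<alpha>\<close> below which fewer than \<open>\<mu>\<close> members agree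
  with \<open>C \<alpha>\<close>. If all indices were of this kind, the code \<open>(w \<alpha>, C \<alpha> \<inter> w \<alpha>)\<close> would map \<open>A\<close>
  into the set of pairs with fibres smaller than \<open>\<mu>\<close>, because indices with equal codes agree
  below their common witness; as there are at least \<open>\<mu>\<close> pairs, \<open>A\<close> would have no more elements
  than there are pairs.
\<close>
lemma exists_popular_index:
  fixes A :: "'b set"
  assumes small: "|SIGMA e : Field r. Pow (underS r e)| <o |A|"
  shows "\<exists>\<alpha>\<in>A. \<forall>e\<in>Field r. r \<le>o |agreeing A C \<alpha> e|"
proof (rule ccontr)
  assume none: "\<not> ?thesis"
  let ?P = "SIGMA e : Field r. Pow (underS r e)"
  have r_le: "r \<le>o |?P|"
  proof -
    have "|Field r| \<le>o |?P|"
      by (rule card_of_ordLeqI[where f = "\<lambda>e. (e, {})"]) (auto simp: inj_on_def)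
    then show ?thesis
      by (rule ordIso_ordLeq_trans[OF ordIso_symmetric[OF card_of_Field_ordIso[OF card]]])
  qed
  then have inf: "infinite ?P"
    using card_of_ordLeq_infinite[OF ordIso_ordLeq_trans[OF card_of_Field_ordIso[OF card]]]
      infinite_Field by blast
  have less: "|X| <o r" if "\<not> r \<le>o |X|" for X :: "'b set"
    using not_ordLeq_iff_ordLess[THEN iffD1, OF card_of_Well_order well_order that] .
  have "\<forall>\<alpha>\<in>A. \<exists>e\<in>Field r. |agreeing A C \<alpha> e| <o r"
    using none less by blast
  then have "\<exists>w. \<forall>\<alpha>\<in>A. w \<alpha> \<in> Field r \<and> |agreeing A C \<alpha> (w \<alpha>)| <o r"
    by (intro bchoice) blast
  then obtain w where w: "\<And>\<alpha>. \<alpha> \<in> A \<Longrightarrow> w \<alpha> \<in> Field r \<and> |agreeing A C \<alpha> (w \<alpha>)| <o r"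
    by blast
  define code where "code \<alpha> = (w \<alpha>, C \<alpha> \<inter> underS r (w \<alpha>))" for \<alpha>
  let ?fibre = "\<lambda>p. {\<alpha> \<in> A. code \<alpha> = p}"
  have fibre: "|?fibre p| \<le>o |?P|" for p
  proof (cases "?fibre p = {}")
    case True
    show ?thesis unfolding True by (rule card_of_empty)
  next
    case False
    then obtain \<alpha> where \<alpha>: "\<alpha> \<in> A" "code \<alpha> = p" by blast
    have "?fibre p \<subseteq> agreeing A C \<alpha> (w \<alpha>)"
    proof
      fix \<beta> assume "\<beta> \<in> ?fibre p"
      then have "\<beta> \<in> A" "code \<beta> = code \<alpha>" using \<alpha>(2) by simp_all
      moreover from this(2) have "w \<beta> = w \<alpha>" unfolding code_def by blast
      ultimately show "\<beta> \<in> agreeing A C \<alpha> (w \<alpha>)" by (simp add: agreeing_def code_def)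
    qed
    then have "|?fibre p| \<le>o |agreeing A C \<alpha> (w \<alpha>)|" by (rule card_of_mono1)
    then show ?thesis
      using w[OF \<alpha>(1)] r_le by (meson ordLess_imp_ordLeq ordLeq_transitive)
  qed
  have cover: "(\<Union>p\<in>?P. ?fibre p) = A" using w by (auto simp: code_def underS_def)
  have "|\<Union>p\<in>?P. ?fibre p| \<le>o |?P|"
    by (intro card_of_UNION_ordLeq_infinite[OF inf] ballI fibre ordLeq_refl card_of_Card_order)
  then have "|A| \<le>o |?P|" unfolding cover .
  with small show False using not_ordLess_ordLeq by blast
qed

text \<open>
  Transfinite recursion: fewer than \<open>\<mu>\<close> values have been used before a given step, so \<open>H e\<close>
  still contains a fresh one.
\<close>
lemma injective_choice:
  assumes "\<And>e. e \<in> Field r \<Longrightarrow> r \<le>o |H e|"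
  shows "\<exists>i. inj_on i (Field r) \<and> (\<forall>e\<in>Field r. i e \<in> H e)"
proof -
  have "\<exists>i. \<forall>e. e \<in> Field r \<longrightarrow> i e \<in> H e - i ` underS r e"
  proof (rule dependent_wf_choice[OF wf_below])
    fix f g :: "'a \<Rightarrow> 'b" and x v
    assume "\<And>z. (z, x) \<in> {(a, b). a \<prec> b} \<Longrightarrow> f z = g z"
    then have "f ` underS r x = g ` underS r x" by (auto intro!: image_cong)
    then show "(x \<in> Field r \<longrightarrow> v \<in> H x - f ` underS r x) =
        (x \<in> Field r \<longrightarrow> v \<in> H x - g ` underS r x)" by simp
  next
    fix x and f :: "'a \<Rightarrow> 'b"
    have "\<not> H x \<subseteq> f ` underS r x" if x: "x \<in> Field r"
    proof
      assume "H x \<subseteq> f ` underS r x"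
      then have "|H x| \<le>o |f ` underS r x|" by (rule card_of_mono1)
      also have "|f ` underS r x| \<le>o |underS r x|" by (rule card_of_image)
      also have "|underS r x| <o r" by (rule card_underS_less[OF x])
      finally show False using assms[OF x] not_ordLess_ordLeq by blast
    qed
    then show "\<exists>v. x \<in> Field r \<longrightarrow> v \<in> H x - f ` underS r x" by blast
  qed
  then obtain i where i: "\<And>e. e \<in> Field r \<Longrightarrow> i e \<in> H e - i ` underS r e" by blast
  have "inj_on i (Field r)"
  proof (rule inj_onI)
    fix x y assume xy: "x \<in> Field r" "y \<in> Field r" "i x = i y"
    then have "\<not> x \<prec> y" "\<not> y \<prec> x" using i[of x] i[of y] by (metis DiffE imageI)+
    then show "x = y" using below_linear xy by blast
  qed
  then show ?thesis using i by blast
qed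

text \<open>
  A point \<open>d\<close> of the diagonal intersection that also lies in \<open>C \<alpha>0\<close> belongs to \<open>C (i e)\<close> for every
  \<open>e\<close>: by diagonality if \<open>e < d\<close>, and by agreement of \<open>C (i e)\<close> with \<open>C \<alpha>0\<close> at \<open>d\<close> otherwise.
\<close>
theorem galvin:
  assumes small: "|SIGMA e : Field r. Pow (underS r e)| <o |A|"
    and C: "\<And>\<alpha>. \<alpha> \<in> A \<Longrightarrow> C \<alpha> \<in> club_filter r"
  shows "\<exists>I\<subseteq>A. |I| =o r \<and> (\<Inter>\<alpha>\<in>I. C \<alpha>) \<in> club_filter r"
proof -
  obtain \<alpha>0 where \<alpha>0: "\<alpha>0 \<in> A" "\<And>e. e \<in> Field r \<Longrightarrow> r \<le>o |agreeing A C \<alpha>0 e|"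
    using exists_popular_index[OF small] by blast
  \<comment> \<open>Agreement below some \<open>u e > e\<close> includes agreement at \<open>e\<close> itself, which settles the
    case \<open>d = e\<close> below.\<close>
  obtain u where u: "\<And>e. e \<in> Field r \<Longrightarrow> e \<prec> u e" using exists_above by metis
  have "r \<le>o |agreeing A C \<alpha>0 (u e)|" if "e \<in> Field r" for e
    using \<alpha>0(2) u that below_Field by blast
  from injective_choice[of "\<lambda>e. agreeing A C \<alpha>0 (u e)", OF this]
  obtain i where inj: "inj_on i (Field r)"
    and i: "\<And>e. e \<in> Field r \<Longrightarrow> i e \<in> agreeing A C \<alpha>0 (u e)" by blast
  have iA: "i e \<in> A" if "e \<in> Field r" for e using i[OF that] by (simp add: agreeing_def)
  have "\<exists>K. club r K \<and> K \<subseteq> C \<alpha>" if "\<alpha> \<in> A" for \<alpha>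
    using C[OF that] unfolding club_filter_def by blast
  then obtain K where K: "\<And>\<alpha>. \<alpha> \<in> A \<Longrightarrow> club r (K \<alpha>) \<and> K \<alpha> \<subseteq> C \<alpha>" by metis
  let ?D = "{d \<in> K \<alpha>0. \<forall>e. e \<prec> d \<longrightarrow> d \<in> K (i e)}"
  have "club r ?D" using club_diagonal[of "K \<alpha>0" "\<lambda>e. K (i e)"] K \<alpha>0(1) iA by blast
  moreover have "?D \<subseteq> (\<Inter>\<alpha>\<in>i ` Field r. C \<alpha>)"
  proof safe
    fix d e assume d: "d \<in> K \<alpha>0" "\<forall>e. e \<prec> d \<longrightarrow> d \<in> K (i e)" and e: "e \<in> Field r"
    have dF: "d \<in> Field r" using d(1) K[OF \<alpha>0(1)] unfolding club_def by blast
    show "d \<in> C (i e)"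
    proof (cases "e \<prec> d")
      case True
      then show ?thesis using d(2) K[OF iA[OF e]] by blast
    next
      case False
      then have "d \<prec> u e" using below_linear[OF e dF] u[OF e] below_trans by blast
      moreover have "d \<in> C \<alpha>0" using d(1) K[OF \<alpha>0(1)] by blast
      ultimately show ?thesis using i[OF e] unfolding agreeing_def by blast
    qed
  qed
  moreover have "(\<Inter>\<alpha>\<in>i ` Field r. C \<alpha>) \<subseteq> Field r"
  proof -
    obtain e where "e \<in> Field r" using infinite_Field infinite_imp_nonempty by blast
    then show ?thesis using C[OF iA] unfolding club_filter_def by blast
  qed
  ultimately have "(\<Inter>\<alpha>\<in>i ` Field r. C \<alpha>) \<in> club_filter r" unfolding club_filter_def by blast
  moreover have "|i ` Field r| =o r"
  proof -
    have "|Field r| =o |i ` Field r|" using inj by (intro card_of_ordIsoI) (auto simp: bij_betw_def)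
    then show ?thesis
      using card_of_Field_ordIso[OF card] ordIso_symmetric ordIso_transitive by blast
  qed
  ultimately show ?thesis using iA by blast
qed

end

section \<open>Counting bounded subsets\<close>

lemma card_Pow_ordLeq_ctwo_cexp:
  assumes "Card_order \<kappa>" "|X| \<le>o \<kappa>"
  shows "|Pow X| \<le>o ctwo ^c \<kappa>"
proof -
  have "|X| \<le>o |Field \<kappa>|"
    using assms card_of_Field_ordIso ordIso_symmetric ordLeq_ordIso_trans by blast
  then obtain f where "inj_on f X" "f ` X \<subseteq> Field \<kappa>" using card_of_ordLeq by metis
  then have "|Pow X| \<le>o |Pow (Field \<kappa>)|"
    by (intro card_of_ordLeqI[where f = "image f"]) (auto intro: inj_on_image_Pow)
  also have "|Pow (Field \<kappa>)| =o ctwo ^c \<kappa>"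
    unfolding cexp_def ctwo_def Field_card_of by (rule card_of_Pow_Func)
  finally show ?thesis .
qed

text \<open>
  There are \<open>\<kappa>\<^sup>+ \<le> 2\<^sup>\<kappa>\<close> initial segments, each of size at most \<open>\<kappa>\<close>.
\<close>
lemma bounded_subsets_of_cardSuc:
  fixes \<kappa> :: "'a rel"
  assumes "Cinfinite \<kappa>"
  shows "|SIGMA e : Field (cardSuc \<kappa>). Pow (underS (cardSuc \<kappa>) e)| \<le>o ctwo ^c \<kappa>"
proof (rule card_of_Sigma_ordLeq_infinite_Field)
  have \<kappa>: "Card_order \<kappa>" using assms by simp
  have suc: "Card_order (cardSuc \<kappa>)" using cardSuc_Card_order[OF \<kappa>] .
  have "\<kappa> <o ctwo ^c \<kappa>" using \<kappa> by (rule ordLess_ctwo_cexp)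
  then have le: "cardSuc \<kappa> \<le>o ctwo ^c \<kappa>" using cardSuc_least[OF \<kappa> Card_order_cexp] by blast
  then show "|Field (cardSuc \<kappa>)| \<le>o ctwo ^c \<kappa>"
    using card_of_Field_ordIso[OF suc] ordIso_ordLeq_trans by blast
  show "infinite (Field (ctwo ^c \<kappa>))"
    using Cinfinite_cexp[OF ordLeq_refl[OF Card_order_ctwo] assms] by (simp add: cinfinite_def)
  show "Card_order (ctwo ^c \<kappa>)" by (rule Card_order_cexp)
  show "\<forall>e\<in>Field (cardSuc \<kappa>). |Pow (underS (cardSuc \<kappa>) e)| \<le>o ctwo ^c \<kappa>"
  proof
    fix e assume "e \<in> Field (cardSuc \<kappa>)"
    then have "|underS (cardSuc \<kappa>) e| <o cardSuc \<kappa>" using card_of_underS[OF suc] by blast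
    then have "|underS (cardSuc \<kappa>) e| \<le>o \<kappa>"
      using cardSuc_ordLeq_ordLess[OF \<kappa> card_of_Card_order] by blast
    then show "|Pow (underS (cardSuc \<kappa>) e)| \<le>o ctwo ^c \<kappa>" by (rule card_Pow_ordLeq_ctwo_cexp[OF \<kappa>])
  qed
qed

text \<open>
  A subset of an initial segment is a two-valued sequence on it, and \<open>2 \<le> r\<close>.
\<close>
lemma bounded_subsets_ordLeq_cexp_less:
  assumes "Cinfinite r"
  shows "|SIGMA e : Field r. Pow (underS r e)| \<le>o cexp_less r r"
  unfolding cexp_less_def
proof (intro card_of_Sigma_mono1 ballI)
  fix e
  have "|Pow (underS r e)| =o ctwo ^c |underS r e|"
    unfolding cexp_def ctwo_def Field_card_of by (rule card_of_Pow_Func)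
  also have "ctwo ^c |underS r e| \<le>o r ^c |underS r e|"
    using assms by (intro cexp_mono1 ctwo_ordLeq_Cinfinite card_of_Card_order)
  finally show "|Pow (underS r e)| \<le>o |Func (underS r e) (Field r)|"
    by (simp add: cexp_def Field_card_of)
qed

lemma Card_order_ordLess_card_Field: "Card_order \<Lambda> \<Longrightarrow> p <o \<Lambda> \<Longrightarrow> p <o |Field \<Lambda>|"
  using card_of_Field_ordIso ordIso_symmetric ordLess_ordIso_trans by blast

section \<open>The two instances\<close>

theorem theorem2p1:
  shows
    "(\<forall>(\<kappa> :: 'a rel) (\<Lambda> :: 'b rel) (C :: 'b \<Rightarrow> 'a set set).
        Cinfinite \<kappa> \<and> ctwo ^c \<kappa> <o ctwo ^c cardSuc \<kappa> \<and>
        Card_order \<Lambda> \<and> ctwo ^c \<kappa> <o \<Lambda> \<and> \<Lambda> \<le>o ctwo ^c cardSuc \<kappa> \<and>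
        (\<forall>\<alpha> \<in> Field \<Lambda>. C \<alpha> \<in> club_filter (cardSuc \<kappa>)) \<longrightarrow>
        (\<exists>I \<subseteq> Field \<Lambda>. |I| =o cardSuc \<kappa> \<and>
           (\<Inter>\<alpha>\<in>I. C \<alpha>) \<in> club_filter (cardSuc \<kappa>)))
     \<and>
     (\<forall>(\<kappa> :: 'c rel) (\<Lambda> :: 'd rel) (C :: 'd \<Rightarrow> 'c set).
        inaccessible_cardinal \<kappa> \<and> \<kappa> =o cexp_less \<kappa> \<kappa> \<and>
        Card_order \<Lambda> \<and> cardSuc \<kappa> \<le>o \<Lambda> \<and> \<Lambda> \<le>o ctwo ^c \<kappa> \<and>
        (\<forall>\<alpha> \<in> Field \<Lambda>. C \<alpha> \<in> club_filter \<kappa>) \<longrightarrow>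
        (\<exists>I \<subseteq> Field \<Lambda>. |I| =o \<kappa> \<and>
           (\<Inter>\<alpha>\<in>I. C \<alpha>) \<in> club_filter \<kappa>))"
proof (intro conjI allI impI; elim conjE)
  fix \<kappa> :: "'a rel" and \<Lambda> :: "'b rel" and C :: "'b \<Rightarrow> 'a set set"
  assume \<kappa>: "cinfinite \<kappa>" "Card_order \<kappa>" and \<Lambda>: "Card_order \<Lambda>" "ctwo ^c \<kappa> <o \<Lambda>"
    and C: "\<forall>\<alpha> \<in> Field \<Lambda>. C \<alpha> \<in> club_filter (cardSuc \<kappa>)"
  have "natLeq \<le>o \<kappa>" using natLeq_ordLeq_cinfinite \<kappa> by blast
  then have "natLeq <o cardSuc \<kappa>" using cardSuc_greater[OF \<kappa>(2)] ordLeq_ordLess_trans by blast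
  then interpret regular_uncountable "cardSuc \<kappa>"
    using \<kappa> by unfold_locales (auto intro: cardSuc_Card_order regularCard_cardSuc)
  have "|SIGMA e : Field (cardSuc \<kappa>). Pow (underS (cardSuc \<kappa>) e)| <o \<Lambda>"
    using bounded_subsets_of_cardSuc \<kappa> \<Lambda>(2) ordLeq_ordLess_trans by blast
  then show "\<exists>I \<subseteq> Field \<Lambda>. |I| =o cardSuc \<kappa> \<and> (\<Inter>\<alpha>\<in>I. C \<alpha>) \<in> club_filter (cardSuc \<kappa>)"
    using C by (intro galvin Card_order_ordLess_card_Field[OF \<Lambda>(1)]) auto
next
  fix \<kappa> :: "'c rel" and \<Lambda> :: "'d rel" and C :: "'d \<Rightarrow> 'c set"
  assume \<kappa>: "inaccessible_cardinal \<kappa>" "\<kappa> =o cexp_less \<kappa> \<kappa>"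
    and \<Lambda>: "Card_order \<Lambda>" "cardSuc \<kappa> \<le>o \<Lambda>"
    and C: "\<forall>\<alpha> \<in> Field \<Lambda>. C \<alpha> \<in> club_filter \<kappa>"
  interpret regular_uncountable \<kappa>
    using \<kappa>(1) unfolding inaccessible_cardinal_def by unfold_locales auto
  have "Cinfinite \<kappa>" using card infinite_Field by (simp add: cinfinite_def)
  then have "|SIGMA e : Field \<kappa>. Pow (underS \<kappa> e)| \<le>o \<kappa>"
    using bounded_subsets_ordLeq_cexp_less \<kappa>(2) ordLeq_ordIso_trans ordIso_symmetric by blast
  moreover have "\<kappa> <o \<Lambda>"
    using cardSuc_greater[OF card] \<Lambda>(2) ordLess_ordLeq_trans by blast
  ultimately have "|SIGMA e : Field \<kappa>. Pow (underS \<kappa> e)| <o \<Lambda>"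
    by (rule ordLeq_ordLess_trans)
  then show "\<exists>I \<subseteq> Field \<Lambda>. |I| =o \<kappa> \<and> (\<Inter>\<alpha>\<in>I. C \<alpha>) \<in> club_filter \<kappa>"
    using C by (intro galvin Card_order_ordLess_card_Field[OF \<Lambda>(1)]) auto
qed

end
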